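(* (1) There exists a regular time-like curve in $\mathbb{L}^4$ that admits a generalized Bishop frame of type D but does not admit one of type F. (2) There exists a regular time-like curve in $\mathbb{L}^4$ that admits a generalized Bishop frame of type C but does not admit one of type D. (3) There exists a regular time-like curve in $\mathbb{L}^4$ that does not admit a generalized Bishop frame of type C.
   Context: $\mathbb{L}^4$ is $\mathbb{R}^4$ with the Lorentzian inner product $\langle\cdot,\cdot\rangle$ of signature $(-,+,+,+)$. Curves $\gamma: I\to\mathbb{L}^4$ are smooth and defined on an open interval $I$. A regular time-like curve is one with $\langle\gamma',\gamma'\rangle<0$ everywhere. It is parametrized by proper time $s$, so that $\mathbb{T}=\gamma'$ satisfies $\langle\mathbb{T},\mathbb{T}\rangle=-1$, and $'$ denotes $d/ds$. An orthonormal frame of $\gamma$ is a smooth family $\{\mathbb{T},\mathbb{Z}_1,\mathbb{Z}_2,\mathbb{Z}_3\}$ along $\gamma$ whose first vector is $\mathbb{T}$, with $\langle\mathbb{T},\mathbb{Z}_i\rangle=0$ and $\langle\mathbb{Z}_i,\mathbb{Z}_j\rangle=\delta_{ij}$. Writing $\mathbb{Z}$ for the matrix with rows $\mathbb{T},\mathbb{Z}_1,\mathbb{Z}_2,\mathbb{Z}_3$, its coefficient matrix is the matrix-valued function $X$ with $\mathbb{Z}'=X\mathbb{Z}$. The frame is called a generalized Bishop frame of type C, D, F respectively if, after some permutation of the last three vectors, its coefficient matrix has the respective form below for some smooth functions $x_1,x_2,x_3$ on $I$ (zeros allowed): $$\text{C}:\begin{pmatrix}0&x_1&x_2&0\\ x_1&0&0&x_3\\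 x_2&0&0&0\\ 0&-x_3&0&0\end{pmatrix},\quad \text{D}:\begin{pmatrix}0&x_1&0&0\\ x_1&0&x_2&x_3\\ 0&-x_2&0&0\\ 0&-x_3&0&0\end{pmatrix},\quad \text{F}:\begin{pmatrix}0&x_1&0&0\\ x_1&0&x_2&0\\ 0&-x_2&0&x_3\\ 0&0&-x_3&0\end{pmatrix}.$$ *)

theory Defs
  imports "HOL-Analysis.Analysis"
begin

text \<open>
  \<open>real ^ 4\<close> stands for Minkowski space. The indices are \<open>1, 2, 3, 4\<close>, with \<open>1\<close> the
  time-like one (in the index type, \<open>4 = 0\<close>).
\<close>

definition lorentz :: "real ^ 4 \<Rightarrow> real ^ 4 \<Rightarrow> real" where
  "lorentz u v = - (u $ 1 * v $ 1) + u $ 2 * v $ 2 + u $ 3 * v $ 3 + u $ 4 * v $ 4"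

text \<open>
  Smoothness is only used for open \<open>I\<close>, where all iterated derivatives at a point of \<open>I\<close> are
  determined by the restriction of \<open>f\<close> to \<open>I\<close>.
\<close>

definition smooth_on :: "real set \<Rightarrow> (real \<Rightarrow> 'a :: real_normed_vector) \<Rightarrow> bool" where
  "smooth_on I f \<longleftrightarrow>
     (\<forall>n. \<forall>t\<in>I. ((\<lambda>g s. vector_derivative g (at s)) ^^ n) f differentiable (at t))"

definition open_interval :: "real set \<Rightarrow> bool" where
  "open_interval I \<longleftrightarrow> open I \<and> is_interval I \<and> I \<noteq> {}"

definition regular_timelike_curve :: "real set \<Rightarrow> (real \<Rightarrow> real ^ 4) \<Rightarrow> bool" where
  "regular_timelike_curve I \<gamma> \<longleftrightarrow> open_interval I \<and> smooth_on I \<gamma> \<and>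
     (\<forall>s\<in>I. lorentz (vector_derivative \<gamma> (at s)) (vector_derivative \<gamma> (at s)) < 0)"

definition proper_time_parametrized :: "real set \<Rightarrow> (real \<Rightarrow> real ^ 4) \<Rightarrow> bool" where
  "proper_time_parametrized I \<gamma> \<longleftrightarrow>
     (\<forall>s\<in>I. lorentz (vector_derivative \<gamma> (at s)) (vector_derivative \<gamma> (at s)) = -1)"

text \<open>A frame is the matrix of its rows: \<open>Z s $ 1\<close> is \<open>T\<close>, and \<open>Z s $ 2, Z s $ 3, Z s $ 4\<close> are
  the three space-like vectors.\<close>

definition orthonormal_frame ::
    "real set \<Rightarrow> (real \<Rightarrow> real ^ 4) \<Rightarrow> (real \<Rightarrow> real ^ 4 ^ 4) \<Rightarrow> bool" where
  "orthonormal_frame I \<gamma> Z \<longleftrightarrow> smooth_on I Z \<and>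
     (\<forall>s\<in>I. Z s $ 1 = vector_derivative \<gamma> (at s) \<and>
        (\<forall>i\<in>{2,3,4}. lorentz (Z s $ 1) (Z s $ i) = 0) \<and>
        (\<forall>i\<in>{2,3,4}. \<forall>j\<in>{2,3,4}. lorentz (Z s $ i) (Z s $ j) = (if i = j then 1 else 0)))"

definition coefficient_matrix ::
    "real set \<Rightarrow> (real \<Rightarrow> real ^ 4 ^ 4) \<Rightarrow> (real \<Rightarrow> real ^ 4 ^ 4) \<Rightarrow> bool" where
  "coefficient_matrix I Z X \<longleftrightarrow> (\<forall>s\<in>I. (Z has_vector_derivative (X s ** Z s)) (at s))"

definition type_C :: "real \<Rightarrow> real \<Rightarrow> real \<Rightarrow> real ^ 4 ^ 4" where
  "type_C x1 x2 x3 = vector [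
     vector [0,   x1,  x2, 0],
     vector [x1,  0,   0,  x3],
     vector [x2,  0,   0,  0],
     vector [0,  -x3,  0,  0]]"

definition type_D :: "real \<Rightarrow> real \<Rightarrow> real \<Rightarrow> real ^ 4 ^ 4" where
  "type_D x1 x2 x3 = vector [
     vector [0,   x1,  0,  0],
     vector [x1,  0,   x2, x3],
     vector [0,  -x2,  0,  0],
     vector [0,  -x3,  0,  0]]"

definition type_F :: "real \<Rightarrow> real \<Rightarrow> real \<Rightarrow> real ^ 4 ^ 4" where
  "type_F x1 x2 x3 = vector [
     vector [0,   x1,  0,   0],
     vector [x1,  0,   x2,  0],
     vector [0,  -x2,  0,   x3],
     vector [0,   0,  -x3,  0]]"

definition generalized_Bishop_frame ::
    "(real \<Rightarrow> real \<Rightarrow> real \<Rightarrow> real ^ 4 ^ 4) \<Rightarrow> real set \<Rightarrow> (real \<Rightarrow> real ^ 4)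
      \<Rightarrow> (real \<Rightarrow> real ^ 4 ^ 4) \<Rightarrow> bool" where
  "generalized_Bishop_frame M I \<gamma> Z \<longleftrightarrow> orthonormal_frame I \<gamma> Z \<and>
     (\<exists>p x1 x2 x3. p permutes {2, 3, 4} \<and>
        smooth_on I x1 \<and> smooth_on I x2 \<and> smooth_on I x3 \<and>
        coefficient_matrix I (\<lambda>s. \<chi> i. Z s $ p i) (\<lambda>s. M (x1 s) (x2 s) (x3 s)))"

definition admits_Bishop_frame ::
    "(real \<Rightarrow> real \<Rightarrow> real \<Rightarrow> real ^ 4 ^ 4) \<Rightarrow> real set \<Rightarrow> (real \<Rightarrow> real ^ 4) \<Rightarrow> bool" where
  "admits_Bishop_frame M I \<gamma> \<longleftrightarrow> (\<exists>Z. generalized_Bishop_frame M I \<gamma> Z)"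

end

theory Submission
  imports Defs
begin

text \<open>
  Where \<open>T'\<close> vanishes to infinite order, its direction may change abruptly although the curve stays
  smooth. A generalized Bishop frame, being smooth, cannot follow every such change, and the
  three types differ in what they tolerate. In each example \<open>T'\<close> vanishes at time \<open>0\<close> only.

  All obstructions have the same form. A frame of type C, D or F contains vectors that are orthogonal to
  \<open>T\<close> and \<open>T'\<close> at all times (\<open>type_C_normal\<close>, \<open>type_D_normals\<close>, \<open>type_F_binormal\<close>). By continuity they
  are orthogonal at time \<open>0\<close> to every limiting direction of \<open>T'\<close> (\<open>lorentz_zero_in_limit\<close>), and too many
  such directions leave no room for them.

  \<^item> Type D requires two orthonormal normals. A boost in one direction that comes to a halt and is
    followed by a boost in another direction gives two limiting directions, which leaves a single line
    for the normals. Yet the frame adapted to the two boosts is of type C.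
  \<^item> Type C requires one normal. If \<open>T'\<close> has one limiting direction from the left, and if \<open>T\<close> runs
    through a logarithmic spiral on a transversal surface from the right, then the limiting directions
    span the space orthogonal to \<open>T\<close>, and no normal is left.
  \<^item> Type D fixes the principal normal up to sign wherever \<open>T' \<noteq> 0\<close>, and so does type F. In type F also the
    derivative of the last vector is orthogonal to \<open>T'\<close>, so the argument applies once more, to the
    derivative of the principal normal. Two null rotations that share the direction of \<open>T'\<close> at time \<open>0\<close>
    but bend towards different directions give a curve of type D with no room for that last vector.

  Every curve is obtained by integrating an explicit path of unit time-like vectors
  (\<open>exists_curve_of_velocity\<close>), and the frames are given by closed formulas, so that no differential
  equation has to be solved.
\<close>

section \<open>Smooth functions on the real line\<close>

text \<open>
  A family of functions that is closed under differentiation consists of smooth functions: every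
  iterated derivative of a member is again a member, hence differentiable. Naming
  such a family avoids any formula for higher derivatives.
\<close>

lemma smooth_on_coinduct:
  assumes "P f"
    and step: "\<And>g. P g \<Longrightarrow> \<exists>g'. P g' \<and> (\<forall>t. (g has_vector_derivative g' t) (at t))"
  shows "smooth_on UNIV f"
proof -
  have "P (((\<lambda>g s. vector_derivative g (at s)) ^^ n) f)" for n
  proof (induction n)
    case 0
    show ?case using \<open>P f\<close> by simp
  next
    case (Suc n)
    from step[OF Suc] obtain g' where "P g'"
      and g': "\<And>t. (((\<lambda>g s. vector_derivative g (at s)) ^^ n) f has_vector_derivative g' t) (at t)"
      by blast
    have "((\<lambda>g s. vector_derivative g (at s)) ^^ Suc n) f = g'"
      using vector_derivative_at[OF g'] by auto
    with \<open>P g'\<close> show ?case by simp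
  qed
  then show ?thesis
    unfolding smooth_on_def using step differentiableI_vector by blast
qed

lemma smooth_on_derivE:
  assumes "smooth_on UNIV f"
  obtains f' where "smooth_on UNIV f'" "\<And>t. (f has_vector_derivative f' t) (at t)"
proof
  let ?D = "\<lambda>g s. vector_derivative g (at s)"
  show "smooth_on UNIV (?D f)"
    unfolding smooth_on_def
  proof (intro allI ballI)
    fix n and t :: real
    have "(?D ^^ Suc n) f differentiable (at t)"
      using assms unfolding smooth_on_def by blast
    then show "(?D ^^ n) (?D f) differentiable (at t)"
      by (simp only: funpow_Suc_right o_apply)
  qed
  have "(?D ^^ 0) f differentiable (at t)" for t
    using assms unfolding smooth_on_def by blast
  then show "(f has_vector_derivative ?D f t) (at t)" for t
    by (simp add: vector_derivative_works)
qed

lemma smooth_on_primitive: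
  assumes "\<And>t. (f has_vector_derivative g t) (at t)" "smooth_on UNIV g"
  shows "smooth_on UNIV f"
proof (rule smooth_on_coinduct[where P="\<lambda>h. h = f \<or> smooth_on UNIV h"])
  show "\<exists>h'. (h' = f \<or> smooth_on UNIV h') \<and> (\<forall>t. (h has_vector_derivative h' t) (at t))"
    if "h = f \<or> smooth_on UNIV h" for h
    using that
  proof
    assume "h = f" then show ?thesis using assms by blast
  next
    assume "smooth_on UNIV h" then show ?thesis by (meson smooth_on_derivE)
  qed
qed simp

lemma smooth_on_const: "smooth_on UNIV (\<lambda>t. c)"
  by (rule smooth_on_coinduct[where P="\<lambda>f. \<exists>c. f = (\<lambda>t. c)"])
    (blast intro: has_vector_derivative_const)+

lemma smooth_on_linear:
  assumes "bounded_linear L" "smooth_on UNIV f"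
  shows "smooth_on UNIV (\<lambda>t. L (f t))"
proof (rule smooth_on_coinduct[where P="\<lambda>g. \<exists>f. smooth_on UNIV f \<and> g = (\<lambda>t. L (f t))"])
  show "\<exists>g'. (\<exists>f. smooth_on UNIV f \<and> g' = (\<lambda>t. L (f t))) \<and>
      (\<forall>t. (g has_vector_derivative g' t) (at t))"
    if "\<exists>f. smooth_on UNIV f \<and> g = (\<lambda>t. L (f t))" for g
  proof -
    from that obtain f f' where g: "g = (\<lambda>t. L (f t))" and "smooth_on UNIV f'"
      and f': "\<And>t. (f has_vector_derivative f' t) (at t)"
      by (metis smooth_on_derivE)
    then have "(g has_vector_derivative L (f' t)) (at t)" for t
      by (simp add: bounded_linear.has_vector_derivative[OF assms(1)])
    with \<open>smooth_on UNIV f'\<close> show ?thesis by blast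
  qed
qed (use assms in blast)

lemma smooth_on_reflect:
  fixes f :: "real \<Rightarrow> real"
  assumes "smooth_on UNIV f"
  shows "smooth_on UNIV (\<lambda>t. f (- t))"
proof (rule smooth_on_coinduct[where P="\<lambda>g. \<exists>c f. smooth_on UNIV f \<and> g = (\<lambda>t. c * f (- t))"])
  show "\<exists>c g. smooth_on UNIV g \<and> (\<lambda>t. f (- t)) = (\<lambda>t. c * g (- t))"
    using assms by (intro exI[of _ 1] exI[of _ f]) simp
  show "\<exists>g'. (\<exists>c f. smooth_on UNIV f \<and> g' = (\<lambda>t. c * f (- t))) \<and>
      (\<forall>t. (g has_vector_derivative g' t) (at t))"
    if "\<exists>c f. smooth_on UNIV f \<and> g = (\<lambda>t. c * f (- t))" for g :: "real \<Rightarrow> real"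
  proof -
    from that obtain c f f' where g: "g = (\<lambda>t. c * f (- t))" and "smooth_on UNIV f'"
      and f': "\<And>t. (f has_vector_derivative f' t) (at t)"
      by (metis smooth_on_derivE)
    have "(f has_real_derivative f' t) (at t)" for t
      using f' by (simp add: has_real_derivative_iff_has_vector_derivative)
    then have "((\<lambda>t. f (- t)) has_real_derivative f' (- t) * - 1) (at t)" for t
      by (rule DERIV_chain2) (auto intro!: derivative_eq_intros)
    from DERIV_cmult[OF this, of c]
    have "(g has_real_derivative - c * f' (- t)) (at t)" for t
      unfolding g by simp
    with \<open>smooth_on UNIV f'\<close> show ?thesis
      unfolding has_real_derivative_iff_has_vector_derivative by blast
  qed
qed

text \<open>
  Products and exponentials of smooth functions do not form a family closed under differentiation,
  but all expressions built from smooth functions by these operations and sums do. The constructor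
  for exponentials is what makes hyperbolic functions of smooth functions available.
\<close>

inductive smooth_generated :: "(real \<Rightarrow> real) \<Rightarrow> bool" where
  base: "smooth_on UNIV f \<Longrightarrow> smooth_generated f"
| add: "smooth_generated f \<Longrightarrow> smooth_generated g \<Longrightarrow> smooth_generated (\<lambda>t. f t + g t)"
| mult: "smooth_generated f \<Longrightarrow> smooth_generated g \<Longrightarrow> smooth_generated (\<lambda>t. f t * g t)"
| exp: "smooth_generated f \<Longrightarrow> smooth_generated (\<lambda>t. exp (f t))"

lemma smooth_generated_deriv:
  assumes "smooth_generated f"
  shows "\<exists>f'. smooth_generated f' \<and> (\<forall>t. (f has_real_derivative f' t) (at t))"
  using assms
proof induction
  case (base f)
  obtain f' where "smooth_on UNIV f'" "\<And>t. (f has_vector_derivative f' t) (at t)"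
    using smooth_on_derivE[OF base] by blast
  then show ?case
    using smooth_generated.base has_real_derivative_iff_has_vector_derivative by blast
next
  case (add f g)
  then obtain f' g' where "smooth_generated f'" "smooth_generated g'"
    and "\<And>t. (f has_real_derivative f' t) (at t)" "\<And>t. (g has_real_derivative g' t) (at t)"
    by blast
  then have "((\<lambda>t. f t + g t) has_real_derivative f' t + g' t) (at t)" for t
    by (intro DERIV_add)
  moreover have "smooth_generated (\<lambda>t. f' t + g' t)"
    by (rule smooth_generated.add) fact+
  ultimately show ?case by blast
next
  case (mult f g)
  then obtain f' g' where "smooth_generated f'" "smooth_generated g'"
    and "\<And>t. (f has_real_derivative f' t) (at t)" "\<And>t. (g has_real_derivative g' t) (at t)"
    by blast
  then have "((\<lambda>t. f t * g t) has_real_derivative f' t * g t + g' t * f t) (at t)" for t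
    by (intro DERIV_mult)
  moreover have "smooth_generated (\<lambda>t. f' t * g t + g' t * f t)"
    by (rule smooth_generated.add; rule smooth_generated.mult) fact+
  ultimately show ?case by blast
next
  case (exp f)
  then obtain f' where "smooth_generated f'" "\<And>t. (f has_real_derivative f' t) (at t)"
    by blast
  then have "((\<lambda>t. exp (f t)) has_real_derivative exp (f t) * f' t) (at t)" for t
    by (intro DERIV_fun_exp)
  moreover have "smooth_generated (\<lambda>t. exp (f t) * f' t)"
    by (rule smooth_generated.mult[OF smooth_generated.exp]) fact+
  ultimately show ?case by blast
qed

lemma smooth_on_generated:
  assumes "smooth_generated f"
  shows "smooth_on UNIV f"
proof (rule smooth_on_coinduct[of smooth_generated])
  fix g assume "smooth_generated g"
  then show "\<exists>g'. smooth_generated g' \<and> (\<forall>t. (g has_vector_derivative g' t) (at t))"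
    using smooth_generated_deriv[of g] unfolding has_real_derivative_iff_has_vector_derivative
    by blast
qed (fact assms)

lemma smooth_on_add: "smooth_on UNIV f \<Longrightarrow> smooth_on UNIV g \<Longrightarrow> smooth_on UNIV (\<lambda>t. f t + g t)"
  for f g :: "real \<Rightarrow> real"
  by (simp add: smooth_on_generated smooth_generated.base smooth_generated.add)

lemma smooth_on_mult: "smooth_on UNIV f \<Longrightarrow> smooth_on UNIV g \<Longrightarrow> smooth_on UNIV (\<lambda>t. f t * g t)"
  for f g :: "real \<Rightarrow> real"
  by (simp add: smooth_on_generated smooth_generated.base smooth_generated.mult)

lemma smooth_on_exp: "smooth_on UNIV f \<Longrightarrow> smooth_on UNIV (\<lambda>t. exp (f t))"
  for f :: "real \<Rightarrow> real"
  by (simp add: smooth_on_generated smooth_generated.base smooth_generated.exp)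

lemma smooth_on_uminus: "smooth_on UNIV f \<Longrightarrow> smooth_on UNIV (\<lambda>t. - f t)"
  for f :: "real \<Rightarrow> real"
  using smooth_on_mult[OF smooth_on_const[of "-1"], of f] by simp

lemma smooth_on_diff: "smooth_on UNIV f \<Longrightarrow> smooth_on UNIV g \<Longrightarrow> smooth_on UNIV (\<lambda>t. f t - g t)"
  for f g :: "real \<Rightarrow> real"
  using smooth_on_add[OF _ smooth_on_uminus, of f g] by simp

lemma smooth_on_divide_const: "smooth_on UNIV f \<Longrightarrow> smooth_on UNIV (\<lambda>t. f t / c)"
  for f :: "real \<Rightarrow> real"
  using smooth_on_mult[OF _ smooth_on_const[of "inverse c"], of f] by (simp add: divide_inverse)

lemma smooth_on_power: "smooth_on UNIV f \<Longrightarrow> smooth_on UNIV (\<lambda>t. f t ^ n)"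
  for f :: "real \<Rightarrow> real"
  by (induction n) (auto intro: smooth_on_const smooth_on_mult)

lemma smooth_on_cosh: "smooth_on UNIV f \<Longrightarrow> smooth_on UNIV (\<lambda>t. cosh (f t))"
  for f :: "real \<Rightarrow> real"
  unfolding cosh_field_def
  by (intro smooth_on_divide_const smooth_on_add smooth_on_exp smooth_on_uminus)

lemma smooth_on_sinh: "smooth_on UNIV f \<Longrightarrow> smooth_on UNIV (\<lambda>t. sinh (f t))"
  for f :: "real \<Rightarrow> real"
  unfolding sinh_field_def
  by (intro smooth_on_divide_const smooth_on_diff smooth_on_exp smooth_on_uminus)

lemma has_vector_derivative_vecI:
  fixes f :: "real \<Rightarrow> 'a :: real_normed_vector ^ 'n"
  assumes "\<And>i. ((\<lambda>t. f t $ i) has_vector_derivative D $ i) (at t)"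
  shows "(f has_vector_derivative D) (at t)"
  unfolding has_vector_derivative_def has_derivative_def
proof (intro conjI vec_tendstoI)
  show "bounded_linear (\<lambda>x. x *\<^sub>R D)" by (rule bounded_linear_scaleR_left)
  fix i
  show "((\<lambda>y. ((f y - f (netlimit (at t)) - (y - netlimit (at t)) *\<^sub>R D) /\<^sub>R
      norm (y - netlimit (at t))) $ i) \<longlongrightarrow> 0 $ i) (at t)"
    using assms[of i] unfolding has_vector_derivative_def has_derivative_def by simp
qed

lemma smooth_on_vecI:
  fixes f :: "real \<Rightarrow> 'a :: real_normed_vector ^ 'n"
  assumes "\<And>i. smooth_on UNIV (\<lambda>t. f t $ i)"
  shows "smooth_on UNIV f"
proof (rule smooth_on_coinduct[where P="\<lambda>f. \<forall>i. smooth_on UNIV (\<lambda>t. f t $ i)"])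
  show "\<exists>g'. (\<forall>i. smooth_on UNIV (\<lambda>t. g' t $ i)) \<and> (\<forall>t. (g has_vector_derivative g' t) (at t))"
    if "\<forall>i. smooth_on UNIV (\<lambda>t. g t $ i)" for g :: "real \<Rightarrow> 'a ^ 'n"
  proof -
    from that have "\<forall>i. \<exists>d. smooth_on UNIV d \<and>
        (\<forall>t. ((\<lambda>t. g t $ i) has_vector_derivative d t) (at t))"
      by (meson smooth_on_derivE)
    then obtain d where "\<And>i. smooth_on UNIV (d i)"
      and "\<And>i t. ((\<lambda>t. g t $ i) has_vector_derivative d i t) (at t)"
      by metis
    then show ?thesis
      by (intro exI[of _ "\<lambda>t. \<chi> i. d i t"]) (auto intro: has_vector_derivative_vecI)
  qed
qed (use assms in blast)

section \<open>Flat functions\<close>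

text \<open>
  For \<open>Re a > 0\<close>, a function that is smooth and vanishes to infinite order at \<open>0\<close> without being
  zero. Admitting a polynomial in \<open>1 / t\<close> as a factor makes the family closed under differentiation,
  and a complex rate \<open>a\<close> covers both the monotone bump \<open>exp (- 1 / t)\<close> and a logarithmic spiral in
  the plane.
\<close>

definition flat :: "complex \<Rightarrow> complex poly \<Rightarrow> real \<Rightarrow> complex" where
  "flat a p t = (if t > 0 then exp (- a / of_real t) * poly p (1 / of_real t) else 0)"

lemma flat_decay:
  assumes "Re a > 0"
  shows "((\<lambda>x. exp (- a * of_real x) * poly p (of_real x)) \<longlongrightarrow> 0) at_top"
proof -
  have monomial: "((\<lambda>x. c * of_real x ^ k * exp (- a * of_real x)) \<longlongrightarrow> 0) at_top" for c k
  proof (rule Lim_null_comparison)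
    have "((\<lambda>x. (Re a * x) ^ k / exp (Re a * x)) \<longlongrightarrow> 0) at_top"
      by (rule filterlim_compose[OF tendsto_power_div_exp_0])
        (use assms in \<open>auto intro: filterlim_tendsto_pos_mult_at_top[OF tendsto_const _ filterlim_ident]\<close>)
    from tendsto_mult[OF tendsto_const[of "norm c / Re a ^ k"] this]
    show "((\<lambda>x. norm c / Re a ^ k * ((Re a * x) ^ k / exp (Re a * x))) \<longlongrightarrow> 0) at_top"
      by simp
    show "\<forall>\<^sub>F x in at_top. norm (c * of_real x ^ k * exp (- a * of_real x)) \<le>
        norm c / Re a ^ k * ((Re a * x) ^ k / exp (Re a * x))"
      using eventually_ge_at_top[of 0]
    proof eventually_elim
      case (elim x)
      then have "norm (c * of_real x ^ k * exp (- a * of_real x)) = norm c * x ^ k * exp (- (Re a * x))"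
        by (simp add: norm_mult norm_power)
      also have "\<dots> = norm c / Re a ^ k * ((Re a * x) ^ k / exp (Re a * x))"
        using assms by (simp add: exp_minus field_simps)
      finally show ?case by simp
    qed
  qed
  have "((\<lambda>x. \<Sum>k\<le>degree p. coeff p k * of_real x ^ k * exp (- a * of_real x)) \<longlongrightarrow> 0) at_top"
    using tendsto_sum[of "{..degree p}", OF monomial] by simp
  then show ?thesis
    by (simp add: poly_altdef sum_distrib_left mult_ac)
qed

text \<open>
  Away from \<open>0\<close> this is the chain rule. At \<open>0\<close> the difference quotient from the right is, in the
  variable \<open>x = 1 / t\<close>, a polynomial times a decaying exponential.
\<close>

lemma flat_has_vector_derivative:
  assumes "Re a > 0"
  shows "(flat a p has_vector_derivative flat a ([:0, 0, 1:] * (smult a p - pderiv p)) t) (at t)"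
proof (cases t "0 :: real" rule: linorder_cases)
  case less
  have "((\<lambda>t. 0) has_vector_derivative flat a ([:0, 0, 1:] * (smult a p - pderiv p)) t) (at t)"
    using less by (simp add: flat_def)
  then show ?thesis
    by (rule has_vector_derivative_transform_within_open[of _ _ _ "{..<0}"])
      (use less in \<open>auto simp: flat_def\<close>)
next
  case greater
  have "((\<lambda>z. exp (- a / z) * poly p (1 / z)) has_field_derivative
      exp (- a / of_real t) * poly ([:0, 0, 1:] * (smult a p - pderiv p)) (1 / of_real t))
      (at (of_real t))"
    using greater
    by (auto intro!: derivative_eq_intros DERIV_chain2[OF poly_DERIV]
        simp: field_simps power2_eq_square)
  from has_vector_derivative_real_field[OF this, where s=UNIV]
  have "((\<lambda>t. exp (- a / of_real t) * poly p (1 / of_real t)) has_vector_derivative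
      flat a ([:0, 0, 1:] * (smult a p - pderiv p)) t) (at t)"
    using greater by (simp only: flat_def if_True)
  then show ?thesis
    by (rule has_vector_derivative_transform_within_open[of _ _ _ "{0<..}"])
      (use greater in \<open>auto simp: flat_def\<close>)
next
  case equal
  have "((\<lambda>x. exp (- a * of_real x) * poly ([:0, 1:] * p) (of_real x)) \<longlongrightarrow> 0) at_top"
    by (rule flat_decay[OF assms])
  from filterlim_compose[OF this filterlim_inverse_at_top_right]
  have "((\<lambda>h. flat a p h /\<^sub>R h) \<longlongrightarrow> 0) (at_right 0)"
    by (rule Lim_transform_eventually)
      (auto simp: eventually_at_right_field flat_def scaleR_conv_of_real field_simps
        intro!: exI[of _ 1])
  moreover have "((\<lambda>h. flat a p h /\<^sub>R h) \<longlongrightarrow> 0) (at_left 0)"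
    by (rule Lim_transform_eventually[OF tendsto_const])
      (auto simp: eventually_at_left_field flat_def intro!: exI[of _ "-1"])
  ultimately have "((\<lambda>h. flat a p h /\<^sub>R h) \<longlongrightarrow> 0) (at 0)"
    by (simp add: filterlim_split_at)
  then show ?thesis
    using equal unfolding has_vector_derivative_def has_derivative_at
    by (auto simp: flat_def tendsto_norm_zero_iff[symmetric, where f="\<lambda>h. _ h /\<^sub>R _ h"] divide_inverse mult.commute
        dest: tendsto_norm_zero)
qed

lemma smooth_on_flat:
  assumes "Re a > 0"
  shows "smooth_on UNIV (flat a p)"
  by (rule smooth_on_coinduct[where P="\<lambda>f. \<exists>p. f = flat a p"])
    (use flat_has_vector_derivative[OF assms] in blast)+

lemmas smooth_intros = smooth_on_const smooth_on_add smooth_on_mult smooth_on_diff smooth_on_uminus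
  smooth_on_power smooth_on_divide_const smooth_on_cosh smooth_on_sinh

definition rise :: "real \<Rightarrow> real" where
  "rise t = (if t > 0 then exp (- 1 / t) else 0)"

definition rise_deriv :: "real \<Rightarrow> real" where
  "rise_deriv t = (if t > 0 then exp (- 1 / t) / t ^ 2 else 0)"

definition fall :: "real \<Rightarrow> real" where
  "fall t = rise (- t)"

definition fall_deriv :: "real \<Rightarrow> real" where
  "fall_deriv t = - rise_deriv (- t)"

lemma rise_eq_flat: "rise = (\<lambda>t. Re (flat 1 1 t))"
  and rise_deriv_eq_flat: "rise_deriv = (\<lambda>t. Re (flat 1 [:0, 0, 1:] t))"
  by (auto simp: fun_eq_iff rise_def rise_deriv_def flat_def Re_exp Im_exp Re_divide Im_divide
      power2_eq_square)

lemma smooth_on_rise: "smooth_on UNIV rise"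
  and smooth_on_rise_deriv: "smooth_on UNIV rise_deriv"
  unfolding rise_eq_flat rise_deriv_eq_flat
  by (rule smooth_on_linear[OF bounded_linear_Re smooth_on_flat]; simp)+

lemma DERIV_rise: "(rise has_real_derivative rise_deriv t) (at t)"
  using bounded_linear.has_vector_derivative[OF bounded_linear_Re flat_has_vector_derivative[of 1 1 t]]
  unfolding rise_eq_flat rise_deriv_eq_flat has_real_derivative_iff_has_vector_derivative
  by (simp add: pderiv_1)

lemma smooth_on_fall: "smooth_on UNIV fall"
  and smooth_on_fall_deriv: "smooth_on UNIV fall_deriv"
  unfolding fall_def fall_deriv_def
  by (intro smooth_intros smooth_on_reflect smooth_on_rise smooth_on_rise_deriv)+

lemma DERIV_fall: "(fall has_real_derivative fall_deriv t) (at t)"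
proof -
  have "((\<lambda>t. rise (- t)) has_real_derivative rise_deriv (- t) * - 1) (at t)"
    by (rule DERIV_chain2[OF DERIV_rise]) (auto intro!: derivative_eq_intros)
  then show ?thesis unfolding fall_def fall_deriv_def by simp
qed

lemmas smooth_flat_intros = smooth_intros smooth_on_rise smooth_on_rise_deriv smooth_on_fall
  smooth_on_fall_deriv

lemmas flat_derivative_intros = derivative_eq_intros DERIV_rise[THEN DERIV_cong] DERIV_fall[THEN DERIV_cong]

lemma rise_nonpos [simp]: "t \<le> 0 \<Longrightarrow> rise t = 0" "t \<le> 0 \<Longrightarrow> rise_deriv t = 0"
  and fall_nonneg [simp]: "t \<ge> 0 \<Longrightarrow> fall t = 0" "t \<ge> 0 \<Longrightarrow> fall_deriv t = 0"
  by (auto simp: rise_def rise_deriv_def fall_def fall_deriv_def)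

lemma rise_deriv_nonzero: "t > 0 \<Longrightarrow> rise_deriv t \<noteq> 0"
  and fall_deriv_nonzero: "t < 0 \<Longrightarrow> fall_deriv t \<noteq> 0"
  by (auto simp: rise_deriv_def fall_deriv_def)

lemma tendsto_rise: "(rise \<longlongrightarrow> 0) (at 0)" and tendsto_fall: "(fall \<longlongrightarrow> 0) (at 0)"
  using DERIV_isCont[OF DERIV_rise, of 0] DERIV_isCont[OF DERIV_fall, of 0]
  by (simp_all add: isCont_def)

section \<open>Minkowski space\<close>

lemma vector_4 [simp]:
  "(vector [a, b, c, d] :: 'a :: zero ^ 4) $ 1 = a"
  "(vector [a, b, c, d] :: 'a ^ 4) $ 2 = b"
  "(vector [a, b, c, d] :: 'a ^ 4) $ 3 = c"
  "(vector [a, b, c, d] :: 'a ^ 4) $ 4 = d"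
  unfolding vector_def by simp_all

lemma smooth_on_vector_4:
  fixes a :: "real \<Rightarrow> 'a :: real_normed_vector"
  assumes "smooth_on UNIV a" "smooth_on UNIV b" "smooth_on UNIV c" "smooth_on UNIV d"
  shows "smooth_on UNIV (\<lambda>t. vector [a t, b t, c t, d t] :: 'a ^ 4)"
proof (rule smooth_on_vecI)
  have "\<forall>i. smooth_on UNIV (\<lambda>t. (vector [a t, b t, c t, d t] :: 'a ^ 4) $ i)"
    unfolding forall_4 using assms by simp
  then show "smooth_on UNIV (\<lambda>t. (vector [a t, b t, c t, d t] :: 'a ^ 4) $ i)" for i ..
qed

lemma has_vector_derivative_vector_4:
  assumes "(a has_real_derivative a') (at t)" "(b has_real_derivative b') (at t)"
    "(c has_real_derivative c') (at t)" "(d has_real_derivative d') (at t)"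
  shows "((\<lambda>t. vector [a t, b t, c t, d t] :: real ^ 4) has_vector_derivative
      vector [a', b', c', d']) (at t)"
proof (rule has_vector_derivative_vecI)
  have "\<forall>i. ((\<lambda>t. (vector [a t, b t, c t, d t] :: real ^ 4) $ i) has_vector_derivative
      (vector [a', b', c', d'] :: real ^ 4) $ i) (at t)"
    unfolding forall_4 using assms by (simp add: has_real_derivative_iff_has_vector_derivative)
  then show "((\<lambda>t. (vector [a t, b t, c t, d t] :: real ^ 4) $ i) has_vector_derivative
      (vector [a', b', c', d'] :: real ^ 4) $ i) (at t)" for i ..
qed

lemma tendsto_vector_4:
  assumes "(a \<longlongrightarrow> a') F" "(b \<longlongrightarrow> b') F" "(c \<longlongrightarrow> c') F" "(d \<longlongrightarrow> d') F"
  shows "((\<lambda>t. vector [a t, b t, c t, d t] :: real ^ 4) \<longlongrightarrow> vector [a', b', c', d']) F"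
proof (rule vec_tendstoI)
  have "\<forall>i. ((\<lambda>t. (vector [a t, b t, c t, d t] :: real ^ 4) $ i) \<longlongrightarrow>
      (vector [a', b', c', d'] :: real ^ 4) $ i) F"
    unfolding forall_4 using assms by simp
  then show "((\<lambda>t. (vector [a t, b t, c t, d t] :: real ^ 4) $ i) \<longlongrightarrow>
      (vector [a', b', c', d'] :: real ^ 4) $ i) F" for i ..
qed

lemma bounded_bilinear_lorentz: "bounded_bilinear lorentz"
  unfolding bilinear_conv_bounded_bilinear[symmetric] bilinear_def linear_iff
  by (auto simp: lorentz_def algebra_simps)

lemmas lorentz_add_left = bounded_bilinear.add_left[OF bounded_bilinear_lorentz]
lemmas lorentz_scaleR_left = bounded_bilinear.scaleR_left[OF bounded_bilinear_lorentz]

text \<open>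
  By integration the path of unit velocities can be prescribed freely. Frames, and the obstructions to
  them, involve the curve only through this path.
\<close>

lemma exists_curve_of_velocity:
  assumes "smooth_on UNIV T" "\<And>s. lorentz (T s) (T s) = -1"
  shows "\<exists>\<gamma>. regular_timelike_curve UNIV \<gamma> \<and> proper_time_parametrized UNIV \<gamma> \<and>
    (\<forall>s. vector_derivative \<gamma> (at s) = T s)"
proof -
  have "isCont T x" for x
    using assms(1) by (metis smooth_on_derivE has_vector_derivative_continuous)
  then obtain \<gamma> where \<gamma>: "\<And>s. (\<gamma> has_vector_derivative T s) (at s)"
    using einterval_antiderivative[of "-\<infinity>" "\<infinity>" T] by auto
  then have "smooth_on UNIV \<gamma>"
    using assms(1) by (rule smooth_on_primitive)
  moreover have "vector_derivative \<gamma> (at s) = T s" for s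
    using \<gamma> by (rule vector_derivative_at)
  ultimately show ?thesis
    using assms(2) unfolding regular_timelike_curve_def proper_time_parametrized_def open_interval_def
    by auto
qed

section \<open>Generalized Bishop frames\<close>

lemma admits_Bishop_frameI:
  assumes "smooth_on UNIV Z" "\<And>s. Z s $ 1 = vector_derivative \<gamma> (at s)"
    and "\<And>s i. i \<in> {2,3,4} \<Longrightarrow> lorentz (Z s $ 1) (Z s $ i) = 0"
    and "\<And>s i j. i \<in> {2,3,4} \<Longrightarrow> j \<in> {2,3,4} \<Longrightarrow>
      lorentz (Z s $ i) (Z s $ j) = (if i = j then 1 else 0)"
    and "smooth_on UNIV x1" "smooth_on UNIV x2" "smooth_on UNIV x3"
    and entries: "\<And>s i j. ((\<lambda>s. Z s $ i $ j) has_real_derivative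
      (M (x1 s) (x2 s) (x3 s) ** Z s) $ i $ j) (at s)"
  shows "admits_Bishop_frame M UNIV \<gamma>"
proof -
  have "coefficient_matrix UNIV Z (\<lambda>s. M (x1 s) (x2 s) (x3 s))"
    unfolding coefficient_matrix_def using entries
    by (auto intro!: has_vector_derivative_vecI
        simp: has_real_derivative_iff_has_vector_derivative)
  then have "\<exists>p x1 x2 x3. p permutes {2, 3, 4} \<and>
      smooth_on UNIV x1 \<and> smooth_on UNIV x2 \<and> smooth_on UNIV x3 \<and>
      coefficient_matrix UNIV (\<lambda>s. \<chi> i. Z s $ p i) (\<lambda>s. M (x1 s) (x2 s) (x3 s))"
    using assms(5-7) by (intro exI[of _ id] exI[of _ x1] exI[of _ x2] exI[of _ x3])
      (simp add: permutes_id)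
  with assms(1-4) show ?thesis
    unfolding admits_Bishop_frame_def generalized_Bishop_frame_def orthonormal_frame_def by blast
qed

text \<open>
  The permutation fixes the first row, so permuting the rows yields another orthonormal frame along
  the curve, and the prescribed coefficient matrix belongs to that frame literally. The first row of
  the matrix expresses the derivative of \<open>T\<close>.
\<close>

lemma Bishop_frame_rowsE:
  assumes "admits_Bishop_frame M UNIV \<gamma>" "\<And>s. vector_derivative \<gamma> (at s) = T s"
    and T': "\<And>s. (T has_vector_derivative T' s) (at s)"
  obtains W X where "\<And>s i. i \<in> {2,3,4} \<Longrightarrow> lorentz (T s) (W s $ i) = 0"
    and "\<And>s i j. i \<in> {2,3,4} \<Longrightarrow> j \<in> {2,3,4} \<Longrightarrow>
      lorentz (W s $ i) (W s $ j) = (if i = j then 1 else 0)"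
    and "\<And>s. \<exists>x1 x2 x3. X s = M x1 x2 x3"
    and "\<And>s. T' s = (\<Sum>k\<in>UNIV. X s $ 1 $ k *\<^sub>R W s $ k)"
    and "\<And>s i. ((\<lambda>s. W s $ i) has_vector_derivative (\<Sum>k\<in>UNIV. X s $ i $ k *\<^sub>R W s $ k)) (at s)"
proof -
  obtain Z p x1 x2 x3 where Z: "orthonormal_frame UNIV \<gamma> Z" and p: "p permutes {2, 3, 4}"
    and X: "coefficient_matrix UNIV (\<lambda>s. \<chi> i. Z s $ p i) (\<lambda>s. M (x1 s) (x2 s) (x3 s))"
    using assms unfolding admits_Bishop_frame_def generalized_Bishop_frame_def by blast
  define W where "W s = (\<chi> i. Z s $ p i)" for s
  define X where "X s = M (x1 s) (x2 s) (x3 s)" for s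
  have p1: "p 1 = 1"
    using p by (rule permutes_not_in) simp
  have pin: "p i \<in> {2, 3, 4}" if "i \<in> {2, 3, 4}" for i
    using permutes_in_image[OF p] that by blast
  have pinj: "p i = p j \<longleftrightarrow> i = j" for i j
    using permutes_inj[OF p] by (auto dest: injD)
  have WT: "W s $ 1 = T s" for s
    using Z assms(2) unfolding orthonormal_frame_def W_def by (simp add: p1)
  have rows: "((\<lambda>s. W s $ i) has_vector_derivative (\<Sum>k\<in>UNIV. X s $ i $ k *\<^sub>R W s $ k)) (at s)"
    for s i
  proof -
    have "(W has_vector_derivative (X s ** W s)) (at s)"
      using X unfolding coefficient_matrix_def W_def X_def by auto
    moreover have "(X s ** W s) $ i = (\<Sum>k\<in>UNIV. X s $ i $ k *\<^sub>R W s $ k)"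
      by (simp add: vec_eq_iff matrix_matrix_mult_def)
    ultimately show ?thesis
      using bounded_linear.has_vector_derivative[OF bounded_linear_vec_nth] by metis
  qed
  show ?thesis
  proof
    show "lorentz (T s) (W s $ i) = 0" if "i \<in> {2,3,4}" for s i
    proof -
      have "\<forall>i\<in>{2,3,4}. lorentz (Z s $ 1) (Z s $ i) = 0"
        using Z unfolding orthonormal_frame_def by blast
      from bspec[OF this pin[OF that]] show ?thesis
        by (simp add: W_def p1 flip: WT)
    qed
    show "lorentz (W s $ i) (W s $ j) = (if i = j then 1 else 0)"
      if "i \<in> {2,3,4}" "j \<in> {2,3,4}" for s i j
    proof -
      have "\<forall>i\<in>{2,3,4}. \<forall>j\<in>{2,3,4}. lorentz (Z s $ i) (Z s $ j) = (if i = j then 1 else 0)"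
        using Z unfolding orthonormal_frame_def by blast
      from bspec[OF bspec[OF this pin[OF that(1)]] pin[OF that(2)]] show ?thesis
        by (simp add: W_def pinj)
    qed
    show "\<exists>x1 x2 x3. X s = M x1 x2 x3" for s
      unfolding X_def by blast
    show "T' s = (\<Sum>k\<in>UNIV. X s $ 1 $ k *\<^sub>R W s $ k)" for s
      using vector_derivative_unique_at[OF T'] rows[of 1 s] unfolding WT by blast
    show "((\<lambda>s. W s $ i) has_vector_derivative (\<Sum>k\<in>UNIV. X s $ i $ k *\<^sub>R W s $ k)) (at s)" for s i
      by (rule rows)
  qed
qed

text \<open>
  The fourth row does not occur in the expansion of the derivative of \<open>T\<close>, so that it is a
  continuous unit normal orthogonal to both \<open>T\<close> and \<open>T'\<close>.
\<close>

lemma type_C_normal: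
  assumes "admits_Bishop_frame type_C UNIV \<gamma>" "\<And>s. vector_derivative \<gamma> (at s) = T s"
    and "\<And>s. (T has_vector_derivative T' s) (at s)"
  obtains w where "\<And>s. isCont w s" "\<And>s. lorentz (T s) (w s) = 0" "\<And>s. lorentz (T' s) (w s) = 0"
    "\<And>s. lorentz (w s) (w s) = 1"
proof (rule Bishop_frame_rowsE[OF assms])
  fix W X
  assume perp: "\<And>s i. i \<in> {2,3,4} \<Longrightarrow> lorentz (T s) (W s $ i) = 0"
    and orth: "\<And>s i j. i \<in> {2,3,4} \<Longrightarrow> j \<in> {2,3,4} \<Longrightarrow>
      lorentz (W s $ i) (W s $ j) = (if i = j then 1 else 0)"
    and X: "\<And>s. \<exists>x1 x2 x3. X s = type_C x1 x2 x3"
    and T': "\<And>s. T' s = (\<Sum>k\<in>UNIV. X s $ 1 $ k *\<^sub>R W s $ k)"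
    and deriv: "\<And>s i. ((\<lambda>s. W s $ i) has_vector_derivative
      (\<Sum>k\<in>UNIV. X s $ i $ k *\<^sub>R W s $ k)) (at s)"
  show ?thesis
  proof (rule that[of "\<lambda>s. W s $ 4"])
    show "isCont (\<lambda>s. W s $ 4) s" for s
      using deriv by (rule has_vector_derivative_continuous)
    show "lorentz (T s) (W s $ 4) = 0" for s
      by (simp add: perp)
    show "lorentz (T' s) (W s $ 4) = 0" for s
    proof -
      from X[of s] obtain x1 x2 x3 where "X s = type_C x1 x2 x3" by blast
      then have "T' s = x1 *\<^sub>R W s $ 2 + x2 *\<^sub>R W s $ 3"
        by (simp add: T' sum_4 type_C_def)
      then show ?thesis
        by (simp add: lorentz_add_left lorentz_scaleR_left orth)
    qed
    show "lorentz (W s $ 4) (W s $ 4) = 1" for s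
      by (simp add: orth)
  qed
qed

text \<open>
  In type D the derivative of \<open>T\<close> is a multiple of the second row, which leaves two
  orthonormal fields perpendicular to both \<open>T\<close> and \<open>T'\<close>.
\<close>

lemma type_D_normals:
  assumes "admits_Bishop_frame type_D UNIV \<gamma>" "\<And>s. vector_derivative \<gamma> (at s) = T s"
    and "\<And>s. (T has_vector_derivative T' s) (at s)"
  obtains w z where "\<And>s. isCont w s" "\<And>s. isCont z s"
    "\<And>s. lorentz (T s) (w s) = 0" "\<And>s. lorentz (T s) (z s) = 0"
    "\<And>s. lorentz (T' s) (w s) = 0" "\<And>s. lorentz (T' s) (z s) = 0"
    "\<And>s. lorentz (w s) (w s) = 1" "\<And>s. lorentz (z s) (z s) = 1" "\<And>s. lorentz (w s) (z s) = 0"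
proof (rule Bishop_frame_rowsE[OF assms])
  fix W X
  assume perp: "\<And>s i. i \<in> {2,3,4} \<Longrightarrow> lorentz (T s) (W s $ i) = 0"
    and orth: "\<And>s i j. i \<in> {2,3,4} \<Longrightarrow> j \<in> {2,3,4} \<Longrightarrow>
      lorentz (W s $ i) (W s $ j) = (if i = j then 1 else 0)"
    and X: "\<And>s. \<exists>x1 x2 x3. X s = type_D x1 x2 x3"
    and T': "\<And>s. T' s = (\<Sum>k\<in>UNIV. X s $ 1 $ k *\<^sub>R W s $ k)"
    and deriv: "\<And>s i. ((\<lambda>s. W s $ i) has_vector_derivative
      (\<Sum>k\<in>UNIV. X s $ i $ k *\<^sub>R W s $ k)) (at s)"
  have T'_multiple: "\<exists>x1. T' s = x1 *\<^sub>R W s $ 2" for s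
  proof -
    from X[of s] obtain x1 x2 x3 where "X s = type_D x1 x2 x3" by blast
    then have "T' s = x1 *\<^sub>R W s $ 2"
      by (simp add: T' sum_4 type_D_def)
    then show ?thesis ..
  qed
  show ?thesis
  proof (rule that[of "\<lambda>s. W s $ 3" "\<lambda>s. W s $ 4"])
    show "isCont (\<lambda>s. W s $ 3) s" "isCont (\<lambda>s. W s $ 4) s" for s
      using deriv by (rule has_vector_derivative_continuous)+
    show "lorentz (T s) (W s $ 3) = 0" "lorentz (T s) (W s $ 4) = 0" for s
      by (simp_all add: perp)
    show "lorentz (T' s) (W s $ 3) = 0" "lorentz (T' s) (W s $ 4) = 0" for s
      using T'_multiple[of s] by (auto simp: lorentz_scaleR_left orth)
  qed (simp_all add: orth)
qed

text \<open>
  The derivative of the last row is a multiple of the third row, and \<open>T'\<close> is a multiple of the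
  second. Thus the last row is orthogonal to \<open>T'\<close> together with its own derivative.
\<close>

lemma type_F_binormal:
  assumes "admits_Bishop_frame type_F UNIV \<gamma>" "\<And>s. vector_derivative \<gamma> (at s) = T s"
    and "\<And>s. (T has_vector_derivative T' s) (at s)"
  obtains w w' where "\<And>s. (w has_vector_derivative w' s) (at s)"
    "\<And>s. lorentz (T s) (w s) = 0" "\<And>s. lorentz (T' s) (w s) = 0" "\<And>s. lorentz (T' s) (w' s) = 0"
    "\<And>s. lorentz (w s) (w s) = 1"
proof (rule Bishop_frame_rowsE[OF assms])
  fix W X
  assume perp: "\<And>s i. i \<in> {2,3,4} \<Longrightarrow> lorentz (T s) (W s $ i) = 0"
    and orth: "\<And>s i j. i \<in> {2,3,4} \<Longrightarrow> j \<in> {2,3,4} \<Longrightarrow>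
      lorentz (W s $ i) (W s $ j) = (if i = j then 1 else 0)"
    and X: "\<And>s. \<exists>x1 x2 x3. X s = type_F x1 x2 x3"
    and T': "\<And>s. T' s = (\<Sum>k\<in>UNIV. X s $ 1 $ k *\<^sub>R W s $ k)"
    and deriv: "\<And>s i. ((\<lambda>s. W s $ i) has_vector_derivative
      (\<Sum>k\<in>UNIV. X s $ i $ k *\<^sub>R W s $ k)) (at s)"
  define w' where "w' s = (\<Sum>k\<in>UNIV. X s $ 4 $ k *\<^sub>R W s $ k)" for s
  have multiples: "\<exists>x1 x3. T' s = x1 *\<^sub>R W s $ 2 \<and> w' s = x3 *\<^sub>R W s $ 3" for s
  proof -
    from X[of s] obtain x1 x2 x3 where "X s = type_F x1 x2 x3" by blast
    then have "T' s = x1 *\<^sub>R W s $ 2 \<and> w' s = (- x3) *\<^sub>R W s $ 3"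
      by (simp add: T' w'_def sum_4 type_F_def)
    then show ?thesis by blast
  qed
  show ?thesis
  proof (rule that[of "\<lambda>s. W s $ 4" w'])
    show "((\<lambda>s. W s $ 4) has_vector_derivative w' s) (at s)" for s
      unfolding w'_def by (rule deriv)
    show "lorentz (T s) (W s $ 4) = 0" for s
      by (simp add: perp)
    show "lorentz (T' s) (W s $ 4) = 0" "lorentz (T' s) (w' s) = 0" for s
      using multiples[of s] by (auto simp: lorentz_scaleR_left
          bounded_bilinear.scaleR_right[OF bounded_bilinear_lorentz] orth)
  qed (simp add: orth)
qed

text \<open>
  Only the limits of the normalised directions \<open>N\<close> matter: a velocity derivative may vanish at the
  limit point and still impose a linear condition there.
\<close>

lemma lorentz_zero_in_limit:
  assumes "(N \<longlongrightarrow> n) F" "(w \<longlongrightarrow> x) F" "\<forall>\<^sub>F t in F. lorentz (N t) (w t) = 0" "F \<noteq> bot"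
  shows "lorentz n x = 0"
proof -
  have "((\<lambda>t. lorentz (N t) (w t)) \<longlongrightarrow> lorentz n x) F"
    by (rule bounded_bilinear.tendsto[OF bounded_bilinear_lorentz assms(1,2)])
  moreover have "((\<lambda>t. lorentz (N t) (w t)) \<longlongrightarrow> 0) F"
    using assms(3) by (rule tendsto_eventually)
  ultimately show ?thesis
    using assms(4) tendsto_unique by blast
qed

lemma lorentz_zero_from_left:
  fixes N w :: "real \<Rightarrow> real ^ 4"
  assumes "(N \<longlongrightarrow> n) (at 0)" "(w \<longlongrightarrow> x) (at 0)" "\<And>t. t < 0 \<Longrightarrow> lorentz (N t) (w t) = 0"
  shows "lorentz n x = 0"
  by (rule lorentz_zero_in_limit[OF tendsto_within_subset[OF assms(1) subset_UNIV]
        tendsto_within_subset[OF assms(2) subset_UNIV], of "{..<0}"])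
    (auto simp: eventually_at_filter assms(3))

lemma lorentz_zero_from_right:
  fixes N w :: "real \<Rightarrow> real ^ 4"
  assumes "(N \<longlongrightarrow> n) (at 0)" "(w \<longlongrightarrow> x) (at 0)" "\<And>t. t > 0 \<Longrightarrow> lorentz (N t) (w t) = 0"
  shows "lorentz n x = 0"
  by (rule lorentz_zero_in_limit[OF tendsto_within_subset[OF assms(1) subset_UNIV]
        tendsto_within_subset[OF assms(2) subset_UNIV], of "{0<..}"])
    (auto simp: eventually_at_filter assms(3))

section \<open>A curve of type D and not of type F\<close>

text \<open>
  Let \<open>A = type_D 1 1 0\<close> and \<open>B = type_D 1 0 1\<close>. Both are nilpotent with vanishing cube (they
  generate null rotations), so their exponentials are quadratic polynomials. The frame below is
  \<open>exp (fall t A)\<close> for \<open>t \<le> 0\<close> and \<open>exp (rise t B)\<close> for \<open>t \<ge> 0\<close>; this path of velocities is its first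
  row, and the next definition is its second.
\<close>

definition velocity_D :: "real \<Rightarrow> real ^ 4" where
  "velocity_D t = vector [1 + fall t ^ 2 / 2 + rise t ^ 2 / 2, fall t + rise t,
     fall t ^ 2 / 2, rise t ^ 2 / 2]"

definition principal_D :: "real \<Rightarrow> real ^ 4" where
  "principal_D t = vector [fall t + rise t, 1, fall t, rise t]"

definition frame_D :: "real \<Rightarrow> real ^ 4 ^ 4" where
  "frame_D t = vector [
     velocity_D t, principal_D t,
     vector [- (fall t ^ 2 / 2), - fall t, 1 - fall t ^ 2 / 2, 0],
     vector [- (rise t ^ 2 / 2), - rise t, 0, 1 - rise t ^ 2 / 2]]"

lemma smooth_frame_D: "smooth_on UNIV velocity_D" "smooth_on UNIV frame_D"
  unfolding velocity_D_def frame_D_def principal_D_def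
  by (intro smooth_on_vector_4 smooth_flat_intros)+

text \<open>
  This dichotomy lets two motions be written in a single formula: at each instant only one of them is
  under way, and the other has coefficients and derivatives zero.
\<close>

lemma fall_zero_or_rise_zero:
  obtains "fall t = 0" "fall_deriv t = 0" | "rise t = 0" "rise_deriv t = 0"
  by (cases "t \<ge> 0") auto

lemma lorentz_vector_4 [simp]:
  "lorentz (vector [a, b, c, d]) (vector [a', b', c', d']) = - (a * a') + b * b' + c * c' + d * d'"
  by (simp add: lorentz_def)

lemma frame_D_type_D:
  assumes "\<And>s. vector_derivative \<gamma> (at s) = velocity_D s"
  shows "admits_Bishop_frame type_D UNIV \<gamma>"
proof (rule admits_Bishop_frameI[where Z=frame_D])
  show "smooth_on UNIV (\<lambda>t. fall_deriv t + rise_deriv t)" "smooth_on UNIV fall_deriv"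
    "smooth_on UNIV rise_deriv"
    by (intro smooth_flat_intros)+
  show "lorentz (frame_D s $ 1) (frame_D s $ i) = 0" if "i \<in> {2,3,4}" for s i
    using that by (cases s rule: fall_zero_or_rise_zero)
      (auto simp: frame_D_def velocity_D_def principal_D_def field_simps power2_eq_square)
  show "lorentz (frame_D s $ i) (frame_D s $ j) = (if i = j then 1 else 0)"
    if "i \<in> {2,3,4}" "j \<in> {2,3,4}" for s i j
    using that by (cases s rule: fall_zero_or_rise_zero)
      (auto simp: frame_D_def velocity_D_def principal_D_def field_simps power2_eq_square)
  fix s :: real
  have "\<forall>i j. ((\<lambda>s. frame_D s $ i $ j) has_real_derivative
      (type_D (fall_deriv s + rise_deriv s) (fall_deriv s) (rise_deriv s) ** frame_D s) $ i $ j) (at s)"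
    unfolding forall_4
    by (cases s rule: fall_zero_or_rise_zero)
      (auto simp: frame_D_def velocity_D_def principal_D_def type_D_def matrix_matrix_mult_def sum_4
         field_simps power2_eq_square intro!: flat_derivative_intros)
  then show "((\<lambda>s. frame_D s $ i $ j) has_real_derivative
      (type_D (fall_deriv s + rise_deriv s) (fall_deriv s) (rise_deriv s) ** frame_D s) $ i $ j) (at s)"
    for i j by blast
qed (use assms smooth_frame_D in \<open>simp_all add: frame_D_def\<close>)

lemma velocity_D_derivative:
  "(velocity_D has_vector_derivative (fall_deriv t + rise_deriv t) *\<^sub>R principal_D t) (at t)"
proof -
  have "(velocity_D has_vector_derivative vector [fall t * fall_deriv t + rise t * rise_deriv t,
      fall_deriv t + rise_deriv t, fall t * fall_deriv t, rise t * rise_deriv t]) (at t)"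
    unfolding velocity_D_def
    by (rule has_vector_derivative_vector_4; auto intro!: flat_derivative_intros)
  also have "vector [fall t * fall_deriv t + rise t * rise_deriv t,
      fall_deriv t + rise_deriv t, fall t * fall_deriv t, rise t * rise_deriv t] =
      (fall_deriv t + rise_deriv t) *\<^sub>R principal_D t"
    by (cases t rule: fall_zero_or_rise_zero) (simp_all add: vec_eq_iff forall_4 principal_D_def)
  finally show ?thesis .
qed

lemma principal_D_derivative:
  "(principal_D has_vector_derivative
    vector [fall_deriv t + rise_deriv t, 0, fall_deriv t, rise_deriv t]) (at t)"
  unfolding principal_D_def
  by (rule has_vector_derivative_vector_4; auto intro!: flat_derivative_intros)

text \<open>
  Let \<open>w\<close> be the last vector of a frame of type F. Since \<open>T'\<close> vanishes only at \<open>0\<close>, both \<open>w\<close> and its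
  derivative are orthogonal to the principal normal off \<open>0\<close>, and \<open>w\<close> is so at \<open>0\<close> by continuity.
  Differentiating this relation shows that \<open>w\<close> is orthogonal to the derivative of the principal
  normal, which points in different directions before and after \<open>0\<close>. At \<open>0\<close> these conditions together
  leave only the zero vector.
\<close>

lemma velocity_D_not_type_F:
  assumes "\<And>s. vector_derivative \<gamma> (at s) = velocity_D s"
  shows "\<not> admits_Bishop_frame type_F UNIV \<gamma>"
proof
  assume "admits_Bishop_frame type_F UNIV \<gamma>"
  then obtain w w' where w': "\<And>s. (w has_vector_derivative w' s) (at s)"
    and perp: "\<And>s. lorentz (velocity_D s) (w s) = 0"
    and perp_w: "\<And>s. lorentz ((fall_deriv s + rise_deriv s) *\<^sub>R principal_D s) (w s) = 0"
    and perp_w': "\<And>s. lorentz ((fall_deriv s + rise_deriv s) *\<^sub>R principal_D s) (w' s) = 0"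
    and unit: "\<And>s. lorentz (w s) (w s) = 1"
    by (rule type_F_binormal[OF _ assms velocity_D_derivative]) blast
  have cont: "(w \<longlongrightarrow> w 0) (at 0)"
    using has_vector_derivative_continuous[OF w'] by (simp add: isCont_def)
  have nonzero: "fall_deriv t + rise_deriv t \<noteq> 0" if "t \<noteq> 0" for t
    using that fall_deriv_nonzero[of t] rise_deriv_nonzero[of t] by (cases "t > 0") auto
  have "lorentz (principal_D t) (w t) = 0" if "t \<noteq> 0" for t
    using perp_w[of t] nonzero[OF that] by (simp add: lorentz_scaleR_left)
  moreover from this have "lorentz (principal_D 0) (w 0) = 0"
  proof (intro lorentz_zero_in_limit[OF _ cont])
    show "(principal_D \<longlongrightarrow> principal_D 0) (at 0)"
      using has_vector_derivative_continuous[OF principal_D_derivative] by (simp add: isCont_def)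
  qed (auto simp: eventually_at_filter)
  ultimately have perp_principal: "lorentz (principal_D t) (w t) = 0" for t
    by metis
  have perp_principal': "lorentz (vector [fall_deriv t + rise_deriv t, 0, fall_deriv t, rise_deriv t]) (w t) = 0"
    if "t \<noteq> 0" for t
  proof -
    have "((\<lambda>t. lorentz (principal_D t) (w t)) has_vector_derivative lorentz (principal_D t) (w' t) +
        lorentz (vector [fall_deriv t + rise_deriv t, 0, fall_deriv t, rise_deriv t]) (w t)) (at t)"
      by (rule bounded_bilinear.has_vector_derivative
          [OF bounded_bilinear_lorentz principal_D_derivative w'])
    then have "((\<lambda>t. 0) has_vector_derivative lorentz (principal_D t) (w' t) +
        lorentz (vector [fall_deriv t + rise_deriv t, 0, fall_deriv t, rise_deriv t]) (w t)) (at t)"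
      unfolding perp_principal .
    from vector_derivative_unique_at[OF this has_vector_derivative_const]
    show ?thesis
      using perp_w'[of t] nonzero[OF that] by (simp add: lorentz_scaleR_left)
  qed
  have "lorentz (vector [1, 0, 1, 0]) (w t) = 0" if "t < 0" for t
  proof -
    have "(vector [fall_deriv t + rise_deriv t, 0, fall_deriv t, rise_deriv t] :: real ^ 4) =
        fall_deriv t *\<^sub>R vector [1, 0, 1, 0]"
      using that by (simp add: vec_eq_iff forall_4)
    then show ?thesis
      using perp_principal'[of t] fall_deriv_nonzero[OF that] that by (simp add: lorentz_scaleR_left)
  qed
  then have left: "lorentz (vector [1, 0, 1, 0]) (w 0) = 0"
    by (rule lorentz_zero_from_left[OF tendsto_const cont])
  have "lorentz (vector [1, 0, 0, 1]) (w t) = 0" if "t > 0" for t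
  proof -
    have "(vector [fall_deriv t + rise_deriv t, 0, fall_deriv t, rise_deriv t] :: real ^ 4) =
        rise_deriv t *\<^sub>R vector [1, 0, 0, 1]"
      using that by (simp add: vec_eq_iff forall_4)
    then show ?thesis
      using perp_principal'[of t] rise_deriv_nonzero[OF that] that by (simp add: lorentz_scaleR_left)
  qed
  then have right: "lorentz (vector [1, 0, 0, 1]) (w 0) = 0"
    by (rule lorentz_zero_from_right[OF tendsto_const cont])
  show False
    using left right perp[of 0] perp_principal[of 0] unit[of 0]
    by (simp add: lorentz_def velocity_D_def principal_D_def)
qed

section \<open>A curve of type C and not of type D\<close>

text \<open>
  A boost in the \<open>2\<close>-direction that comes to a halt at time \<open>0\<close>, followed by a boost in the
  \<open>3\<close>-direction. The constant \<open>- 1\<close> compensates for the hyperbolic cosine of the motion that is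
  at rest.
\<close>

definition velocity_C :: "real \<Rightarrow> real ^ 4" where
  "velocity_C t = vector [cosh (fall t) + cosh (rise t) - 1, sinh (fall t), sinh (rise t), 0]"

definition frame_C :: "real \<Rightarrow> real ^ 4 ^ 4" where
  "frame_C t = vector [
     velocity_C t,
     vector [sinh (fall t), cosh (fall t), 0, 0],
     vector [sinh (rise t), 0, cosh (rise t), 0],
     vector [0, 0, 0, 1]]"

lemma smooth_frame_C: "smooth_on UNIV velocity_C" "smooth_on UNIV frame_C"
  unfolding velocity_C_def frame_C_def
  by (intro smooth_on_vector_4 smooth_flat_intros)+

definition velocity_C_deriv :: "real \<Rightarrow> real ^ 4" where
  "velocity_C_deriv t = vector [sinh (fall t) * fall_deriv t + sinh (rise t) * rise_deriv t,
     cosh (fall t) * fall_deriv t, cosh (rise t) * rise_deriv t, 0]"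

lemma velocity_C_derivative: "(velocity_C has_vector_derivative velocity_C_deriv t) (at t)"
  unfolding velocity_C_def velocity_C_deriv_def
  by (rule has_vector_derivative_vector_4; auto intro!: flat_derivative_intros)

lemma frame_C_type_C:
  assumes "\<And>s. vector_derivative \<gamma> (at s) = velocity_C s"
  shows "admits_Bishop_frame type_C UNIV \<gamma>"
proof (rule admits_Bishop_frameI[where Z=frame_C])
  show "smooth_on UNIV fall_deriv" "smooth_on UNIV rise_deriv" "smooth_on UNIV (\<lambda>t. 0 :: real)"
    by (intro smooth_flat_intros)+
  show "lorentz (frame_C s $ 1) (frame_C s $ i) = 0" if "i \<in> {2,3,4}" for s i
    using that by (cases s rule: fall_zero_or_rise_zero)
      (auto simp: frame_C_def velocity_C_def)
  show "lorentz (frame_C s $ i) (frame_C s $ j) = (if i = j then 1 else 0)"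
    if "i \<in> {2,3,4}" "j \<in> {2,3,4}" for s i j
    using that by (cases s rule: fall_zero_or_rise_zero)
      (auto simp: frame_C_def cosh_square_eq simp flip: power2_eq_square)
  fix s :: real
  have "\<forall>i j. ((\<lambda>s. frame_C s $ i $ j) has_real_derivative
      (type_C (fall_deriv s) (rise_deriv s) 0 ** frame_C s) $ i $ j) (at s)"
    unfolding forall_4
    by (cases s rule: fall_zero_or_rise_zero)
      (auto simp: frame_C_def velocity_C_def type_C_def matrix_matrix_mult_def sum_4
         intro!: flat_derivative_intros)
  then show "((\<lambda>s. frame_C s $ i $ j) has_real_derivative
      (type_C (fall_deriv s) (rise_deriv s) 0 ** frame_C s) $ i $ j) (at s)"
    for i j by blast
qed (use assms smooth_frame_C in \<open>simp_all add: frame_C_def\<close>)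

text \<open>
  The direction of the velocity derivative tends to the second axis from the left and to the third
  axis from the right.
\<close>

lemma velocity_C_normal_at_0:
  assumes cont: "isCont w 0"
    and perp: "\<And>t. lorentz (velocity_C t) (w t) = 0"
    and perp': "\<And>t. lorentz (velocity_C_deriv t) (w t) = 0"
  shows "w 0 $ 1 = 0 \<and> w 0 $ 2 = 0 \<and> w 0 $ 3 = 0"
proof -
  have lim: "((\<lambda>t. cosh (fall t)) \<longlongrightarrow> 1) (at 0)" "((\<lambda>t. sinh (fall t)) \<longlongrightarrow> 0) (at 0)"
    "((\<lambda>t. cosh (rise t)) \<longlongrightarrow> 1) (at 0)" "((\<lambda>t. sinh (rise t)) \<longlongrightarrow> 0) (at 0)"
    using tendsto_cosh[OF tendsto_fall] tendsto_sinh[OF tendsto_fall]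
      tendsto_cosh[OF tendsto_rise] tendsto_sinh[OF tendsto_rise] by simp_all
  have w: "(w \<longlongrightarrow> w 0) (at 0)"
    using cont by (simp add: isCont_def)
  have "lorentz (vector [sinh (fall t), cosh (fall t), 0, 0]) (w t) = 0" if "t < 0" for t
  proof -
    have "velocity_C_deriv t = fall_deriv t *\<^sub>R vector [sinh (fall t), cosh (fall t), 0, 0]"
      using that by (simp add: velocity_C_deriv_def vec_eq_iff forall_4)
    then show ?thesis
      using perp'[of t] fall_deriv_nonzero[OF that] by (simp add: lorentz_scaleR_left)
  qed
  then have "lorentz (vector [0, 1, 0, 0]) (w 0) = 0"
    by (rule lorentz_zero_from_left[OF tendsto_vector_4[OF lim(2,1) tendsto_const tendsto_const] w])
  moreover have "lorentz (vector [sinh (rise t), 0, cosh (rise t), 0]) (w t) = 0" if "t > 0" for t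
  proof -
    have "velocity_C_deriv t = rise_deriv t *\<^sub>R vector [sinh (rise t), 0, cosh (rise t), 0]"
      using that by (simp add: velocity_C_deriv_def vec_eq_iff forall_4)
    then show ?thesis
      using perp'[of t] rise_deriv_nonzero[OF that] by (simp add: lorentz_scaleR_left)
  qed
  then have "lorentz (vector [0, 0, 1, 0]) (w 0) = 0"
    by (rule lorentz_zero_from_right[OF tendsto_vector_4[OF lim(4) tendsto_const lim(3) tendsto_const] w])
  ultimately show ?thesis
    using perp[of 0] by (simp add: lorentz_def velocity_C_def vec_eq_iff forall_4)
qed

text \<open>
  A frame of type D would need two orthonormal vectors in the line left over by the preceding lemma.
\<close>

lemma velocity_C_not_type_D:
  assumes "\<And>s. vector_derivative \<gamma> (at s) = velocity_C s"
  shows "\<not> admits_Bishop_frame type_D UNIV \<gamma>"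
proof
  assume "admits_Bishop_frame type_D UNIV \<gamma>"
  then show False
  proof (rule type_D_normals[OF _ assms velocity_C_derivative])
    fix w z
    assume "\<And>s. isCont w s" "\<And>s. isCont z s"
      "\<And>s. lorentz (velocity_C s) (w s) = 0" "\<And>s. lorentz (velocity_C s) (z s) = 0"
      "\<And>s. lorentz (velocity_C_deriv s) (w s) = 0" "\<And>s. lorentz (velocity_C_deriv s) (z s) = 0"
    then have at_0: "w 0 $ 1 = 0 \<and> w 0 $ 2 = 0 \<and> w 0 $ 3 = 0" "z 0 $ 1 = 0 \<and> z 0 $ 2 = 0 \<and> z 0 $ 3 = 0"
      using velocity_C_normal_at_0[of w] velocity_C_normal_at_0[of z] by blast+
    assume orth: "\<And>s. lorentz (w s) (w s) = 1" "\<And>s. lorentz (z s) (z s) = 1"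
      "\<And>s. lorentz (w s) (z s) = 0"
    have "w 0 $ 4 * w 0 $ 4 = 1" "z 0 $ 4 * z 0 $ 4 = 1" "w 0 $ 4 * z 0 $ 4 = 0"
      using at_0 orth[of 0] by (simp_all add: lorentz_def)
    then show False by auto
  qed
qed

section \<open>A curve that is not of type C\<close>

definition spiral :: "real \<Rightarrow> complex" where
  "spiral = flat (1 - \<i>) 1"

definition spiral_deriv :: "real \<Rightarrow> complex" where
  "spiral_deriv = flat (1 - \<i>) [:0, 0, 1 - \<i>:]"

lemma spiral_nonpos [simp]: "t \<le> 0 \<Longrightarrow> spiral t = 0" "t \<le> 0 \<Longrightarrow> spiral_deriv t = 0"
  by (auto simp: spiral_def spiral_deriv_def flat_def)

lemma spiral_inverse:
  assumes "x > 0"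
  shows "Re (spiral (inverse x)) = exp (- x) * cos x" "Im (spiral (inverse x)) = exp (- x) * sin x"
    "Re (spiral_deriv (inverse x)) = x ^ 2 * exp (- x) * (cos x + sin x)"
    "Im (spiral_deriv (inverse x)) = x ^ 2 * exp (- x) * (sin x - cos x)"
  using assms
  by (simp_all add: spiral_def spiral_deriv_def flat_def Re_exp Im_exp field_simps power2_eq_square)

lemma smooth_on_spiral: "smooth_on UNIV (\<lambda>t. Re (spiral t))" "smooth_on UNIV (\<lambda>t. Im (spiral t))"
  unfolding spiral_def
  by (rule smooth_on_linear[OF bounded_linear_Re smooth_on_flat]
      smooth_on_linear[OF bounded_linear_Im smooth_on_flat]; simp)+

lemma DERIV_spiral:
  "((\<lambda>t. Re (spiral t)) has_real_derivative Re (spiral_deriv t)) (at t)"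
  "((\<lambda>t. Im (spiral t)) has_real_derivative Im (spiral_deriv t)) (at t)"
  using flat_has_vector_derivative[of "1 - \<i>" 1 t]
  unfolding spiral_def spiral_deriv_def has_vector_derivative_complex_iff by (simp_all add: pderiv_1)

text \<open>
  For \<open>t \<ge> 0\<close> this path lies on a horosphere, parametrised by the plane in which the spiral runs; for
  \<open>t \<le> 0\<close> it follows a null rotation whose direction of motion at \<open>0\<close> is transversal to that horosphere.
\<close>

definition velocity_spiral :: "real \<Rightarrow> real ^ 4" where
  "velocity_spiral t = vector [
     1 + fall t ^ 2 / 2 + (Re (spiral t) ^ 2 + Im (spiral t) ^ 2) / 2,
     fall t + (Re (spiral t) ^ 2 + Im (spiral t) ^ 2) / 2,
     fall t ^ 2 / 2 + Re (spiral t),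
     Im (spiral t)]"

definition velocity_spiral_deriv :: "real \<Rightarrow> real ^ 4" where
  "velocity_spiral_deriv t = vector [
     fall t * fall_deriv t + (Re (spiral t) * Re (spiral_deriv t) + Im (spiral t) * Im (spiral_deriv t)),
     fall_deriv t + (Re (spiral t) * Re (spiral_deriv t) + Im (spiral t) * Im (spiral_deriv t)),
     fall t * fall_deriv t + Re (spiral_deriv t),
     Im (spiral_deriv t)]"

lemma smooth_velocity_spiral: "smooth_on UNIV velocity_spiral"
  unfolding velocity_spiral_def by (intro smooth_on_vector_4 smooth_flat_intros smooth_on_spiral)

lemma velocity_spiral_derivative: "(velocity_spiral has_vector_derivative velocity_spiral_deriv t) (at t)"
  unfolding velocity_spiral_def velocity_spiral_deriv_def
  by (rule has_vector_derivative_vector_4;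
      auto intro!: flat_derivative_intros DERIV_spiral[THEN DERIV_cong])

lemma velocity_spiral_unit: "lorentz (velocity_spiral t) (velocity_spiral t) = -1"
  by (cases "t \<ge> 0") (auto simp: velocity_spiral_def power2_eq_square field_simps)

text \<open>
  The second axis is the limiting direction of the velocity derivative from the left. The tangent of a
  logarithmic spiral makes a constant angle with the radius and therefore turns infinitely often as
  \<open>t\<close> decreases to \<open>0\<close>, so from the right every direction in the plane of the last two axes is a
  limiting direction. A continuous normal orthogonal to all of these vanishes at \<open>0\<close>.
\<close>

lemma velocity_spiral_not_type_C:
  assumes "\<And>s. vector_derivative \<gamma> (at s) = velocity_spiral s"
  shows "\<not> admits_Bishop_frame type_C UNIV \<gamma>"
proof
  assume "admits_Bishop_frame type_C UNIV \<gamma>"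
  then obtain w where cont: "isCont w 0" and perp: "lorentz (velocity_spiral 0) (w 0) = 0"
    and perp': "\<And>s. lorentz (velocity_spiral_deriv s) (w s) = 0" and unit: "lorentz (w 0) (w 0) = 1"
    by (rule type_C_normal[OF _ assms velocity_spiral_derivative]) blast
  have w: "(w \<longlongrightarrow> w 0) (at 0)"
    using cont by (simp add: isCont_def)
  have "lorentz (vector [fall t, 1, fall t, 0]) (w t) = 0" if "t < 0" for t
  proof -
    have "velocity_spiral_deriv t = fall_deriv t *\<^sub>R vector [fall t, 1, fall t, 0]"
      using that by (simp add: velocity_spiral_deriv_def vec_eq_iff forall_4)
    then show ?thesis
      using perp'[of t] fall_deriv_nonzero[OF that] by (simp add: lorentz_scaleR_left)
  qed
  then have left: "lorentz (vector [0, 1, 0, 0]) (w 0) = 0"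
    by (rule lorentz_zero_from_left[OF
          tendsto_vector_4[OF tendsto_fall tendsto_const tendsto_fall tendsto_const] w])
  have right: "lorentz (vector [0, 0, cos \<theta> + sin \<theta>, sin \<theta> - cos \<theta>]) (w 0) = 0" if "\<theta> \<ge> 0" for \<theta>
  proof -
    \<comment> \<open>the instants at which the spiral has polar angle \<open>\<theta>\<close>; the successor keeps them positive when \<open>\<theta> = 0\<close>\<close>
    define x where "x n = \<theta> + 2 * real (Suc n) * pi" for n
    have x_pos: "x n > 0" for n
      using that by (auto simp: x_def intro!: add_nonneg_pos)
    have cos_x: "cos (x n) = cos \<theta>" and sin_x: "sin (x n) = sin \<theta>" for n
      unfolding x_def cos_add sin_add cos_2npi sin_2npi by simp_all
    have "filterlim (\<lambda>n. real (Suc n)) at_top sequentially"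
      by (rule filterlim_compose[OF filterlim_real_sequentially filterlim_Suc])
    then have x_lim: "filterlim x at_top sequentially"
      unfolding x_def by (intro filterlim_tendsto_add_at_top[OF tendsto_const]
          filterlim_at_top_mult_tendsto_pos[OF tendsto_const]
          filterlim_tendsto_pos_mult_at_top[OF tendsto_const]) auto
    have decay: "(\<lambda>n. exp (- x n)) \<longlonglongrightarrow> 0"
      by (rule filterlim_compose[OF exp_at_bot]) (use x_lim in \<open>simp add: filterlim_uminus_at_bot\<close>)
    have "(\<lambda>n. inverse (x n)) \<longlonglongrightarrow> 0"
      by (rule filterlim_compose[OF tendsto_inverse_0_at_top[OF filterlim_ident] x_lim])
    then have w_lim: "(\<lambda>n. w (inverse (x n))) \<longlonglongrightarrow> w 0"
      by (rule isCont_tendsto_compose[OF cont])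
    have "lorentz (vector [exp (- x n), exp (- x n), cos \<theta> + sin \<theta>, sin \<theta> - cos \<theta>])
        (w (inverse (x n))) = 0" for n
    proof -
      have "e * c * (y * e * (c + s)) + e * s * (y * e * (s - c)) = y * e * e * (c * c + s * s)"
        for e c s y :: real
        by (simp add: algebra_simps)
      from this[of "exp (- x n)" "cos \<theta>" "x n ^ 2" "sin \<theta>"]
      have "exp (- x n) * cos \<theta> * (x n ^ 2 * exp (- x n) * (cos \<theta> + sin \<theta>)) +
          exp (- x n) * sin \<theta> * (x n ^ 2 * exp (- x n) * (sin \<theta> - cos \<theta>)) =
          x n ^ 2 * exp (- x n) * exp (- x n)"
        unfolding sin_cos_squared_add3 by simp
      then have "velocity_spiral_deriv (inverse (x n)) = (x n ^ 2 * exp (- x n)) *\<^sub>R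
          vector [exp (- x n), exp (- x n), cos \<theta> + sin \<theta>, sin \<theta> - cos \<theta>]"
        using x_pos[of n]
        by (simp add: velocity_spiral_deriv_def vec_eq_iff forall_4 spiral_inverse cos_x sin_x)
      then show ?thesis
        using perp'[of "inverse (x n)"] x_pos[of n] by (simp add: lorentz_scaleR_left)
    qed
    then show ?thesis
      by (intro lorentz_zero_in_limit[OF _ w_lim, of
            "\<lambda>n. vector [exp (- x n), exp (- x n), cos \<theta> + sin \<theta>, sin \<theta> - cos \<theta>]"]
          tendsto_vector_4 tendsto_const decay) simp_all
  qed
  show False
    \<comment> \<open>the angles \<open>0\<close> and \<open>pi / 2\<close> give the directions \<open>(1, -1)\<close> and \<open>(1, 1)\<close>, which span the plane\<close>
    using perp left right[of 0] right[of "pi / 2"] unit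
    by (simp add: lorentz_def velocity_spiral_def)
qed

section \<open>Separation of the types\<close>

theorem theorem1p3:
  shows "(\<exists>I \<gamma>. regular_timelike_curve I \<gamma> \<and> proper_time_parametrized I \<gamma> \<and>
            admits_Bishop_frame type_D I \<gamma> \<and> \<not> admits_Bishop_frame type_F I \<gamma>) \<and>
         (\<exists>I \<gamma>. regular_timelike_curve I \<gamma> \<and> proper_time_parametrized I \<gamma> \<and>
            admits_Bishop_frame type_C I \<gamma> \<and> \<not> admits_Bishop_frame type_D I \<gamma>) \<and>
         (\<exists>I \<gamma>. regular_timelike_curve I \<gamma> \<and> proper_time_parametrized I \<gamma> \<and>
            \<not> admits_Bishop_frame type_C I \<gamma>)"
proof (intro conjI)
  have "lorentz (velocity_D s) (velocity_D s) = -1" for s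
    by (cases s rule: fall_zero_or_rise_zero)
      (auto simp: velocity_D_def power2_eq_square field_simps)
  from exists_curve_of_velocity[OF smooth_frame_D(1) this]
  show "\<exists>I \<gamma>. regular_timelike_curve I \<gamma> \<and> proper_time_parametrized I \<gamma> \<and>
      admits_Bishop_frame type_D I \<gamma> \<and> \<not> admits_Bishop_frame type_F I \<gamma>"
    using frame_D_type_D velocity_D_not_type_F by blast
  have "lorentz (velocity_C s) (velocity_C s) = -1" for s
    by (cases s rule: fall_zero_or_rise_zero)
      (auto simp: velocity_C_def cosh_square_eq simp flip: power2_eq_square)
  from exists_curve_of_velocity[OF smooth_frame_C(1) this]
  show "\<exists>I \<gamma>. regular_timelike_curve I \<gamma> \<and> proper_time_parametrized I \<gamma> \<and>
      admits_Bishop_frame type_C I \<gamma> \<and> \<not> admits_Bishop_frame type_D I \<gamma>"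
    using frame_C_type_C velocity_C_not_type_D by blast
  from exists_curve_of_velocity[OF smooth_velocity_spiral velocity_spiral_unit]
  show "\<exists>I \<gamma>. regular_timelike_curve I \<gamma> \<and> proper_time_parametrized I \<gamma> \<and>
      \<not> admits_Bishop_frame type_C I \<gamma>"
    using velocity_spiral_not_type_C by blast
qed

end
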